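(* Let $\varphi$ be a pseudomultiplier of a Hilbert function space $\mathcal H$ on a set $\Omega$ and let $\alpha\in\Omega$. Then $\alpha$ is an ambiguous point for $\varphi$ if and only if $\varphi$ sees $k_\alpha$ with arbitrary value (that is, for every $c\in\mathbb C$, $\varphi$ sees $k_\alpha$ with value $c$).
   Context: A Hilbert function space on a set $\Omega$ is a complex Hilbert space $\mathcal H$ whose elements are complex-valued functions on $\Omega$ (with pointwise operations) such that for each $\lambda\in\Omega$ the functional $f\mapsto f(\lambda)$ is continuous; $k_\lambda\in\mathcal H$ denotes the element with $f(\lambda)=\langle f,k_\lambda\rangle$ for all $f\in\mathcal H$. A subset $D\subset\Omega$ is a set of uniqueness for $\mathcal H$ if any $f,g\in\mathcal H$ that agree on $D$ are equal. A function $\varphi:D_\varphi\subset\Omega\to\mathbb C$ is a pseudomultiplier of $\mathcal H$ if (1) $D_\varphi$ is a set of uniqueness for $\mathcal H$; (2) $E_\varphi=\{h\in\mathcal H:\text{ there exists } g\in\mathcal H \text{ with } g(\lambda)=\varphi(\lambda)h(\lambda)\text{ for all }\lambda\in D_\varphi\}$ is closed in $\mathcal H$; (3) $E_\varphi$ has finite codimension in $\mathcal H$. Then $X_\varphi:E_\varphi\to\mathcal H$ is defined by $X_\varphi h=g$, where $g$ is the unique element of $\mathcal H$ with $g=\varphi h$ on $D_\varphi$. Seeing a vector: for $v\in\mathcal H$, let $p\notin\Omega$, and for $f\in\mathcal H$ define $f_v:\Omega\cup\{p\}\to\mathbb C$ by $f_v=f$ on $\Omega$ and $f_v(p)=\langle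 f,v\rangle$. Let $\mathcal H_v=\{f_v:f\in\mathcal H\}$ with $\langle f_v,g_v\rangle_{\mathcal H_v}=\langle f,g\rangle_{\mathcal H}$; this is a Hilbert function space on $\Omega\cup\{p\}$. The pseudomultiplier $\varphi$ of $\mathcal H$ sees $v$ with value $c\in\mathbb C$ if there exists a pseudomultiplier $\psi$ of $\mathcal H_v$ such that $D_\varphi\subseteq D_\psi$, $\psi|D_\varphi=\varphi$, $p\in D_\psi$, $E_\varphi=E_\psi|\Omega:=\{F|\Omega:F\in E_\psi\}$, and $\psi(p)=c$. Ambiguous points: (a) For $\alpha\in D_\varphi$ and $c\in\mathbb C$ let $\varphi_{c,\alpha}$ be the function on $D_\varphi$ equal to $\varphi$ on $D_\varphi\setminus\{\alpha\}$ and equal to $c$ at $\alpha$ (with $E_{\varphi_{c,\alpha}}$, $X_{\varphi_{c,\alpha}}$ defined as for $\varphi$). The point $\alpha\in D_\varphi$ is an ambiguous point for $\varphi$ if there exists $c\neq\varphi(\alpha)$ such that $E_\varphi=E_{\varphi_{c,\alpha}}$ and $X_{\varphi_{c,\alpha}}=X_\varphi$. (b) A point $\alpha\in\Omega\setminus D_\varphi$ is an ambiguous point for $\varphi$ if there exists $c\in\mathbb C$ such that $\varphi$ sees $k_\alpha$ with value $c$ and $\alpha$ is an ambiguous point, in the sense of (a), for the pseudomultiplier $\psi_{c,\alpha}$ defined on $D_\varphi\cup\{\alpha\}$ by $\psi_{c,\alpha}=\varphi$ on $D_\varphi$ and $\psi_{c,\alpha}(\alpha)=c$. *)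

theory Defs
  imports "HOL-Analysis.Analysis" "HOL-Library.Function_Algebras"
begin

text \<open>
  Functions on a set \<open>\<Omega>\<close> are total functions vanishing off \<open>\<Omega>\<close>, so that equality of elements is
  equality on \<open>\<Omega>\<close> and the vector operations are the pointwise ones of type \<^typ>\<open>'a \<Rightarrow> complex\<close>.
\<close>

definition fscale :: "complex \<Rightarrow> ('a \<Rightarrow> complex) \<Rightarrow> 'a \<Rightarrow> complex" where
  "fscale c f = (\<lambda>x. c * f x)"

interpretation fun_space: vector_space "fscale :: complex \<Rightarrow> ('a \<Rightarrow> complex) \<Rightarrow> 'a \<Rightarrow> complex"
  by unfold_locales (auto simp: fscale_def algebra_simps fun_eq_iff)

record 'a function_space =
  points :: "'a set"
  elems :: "('a \<Rightarrow> complex) set"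
  ip :: "('a \<Rightarrow> complex) \<Rightarrow> ('a \<Rightarrow> complex) \<Rightarrow> complex"

text \<open>
  The locale \<^locale>\<open>Metric_space\<close> demands nonnegativity and symmetry of the distance on the whole
  type, hence the case distinction.
\<close>

definition hdist :: "'a function_space \<Rightarrow> ('a \<Rightarrow> complex) \<Rightarrow> ('a \<Rightarrow> complex) \<Rightarrow> real" where
  "hdist \<H> f g =
     (if f \<in> elems \<H> \<and> g \<in> elems \<H> then sqrt (Re (ip \<H> (f - g) (f - g))) else 0)"

abbreviation htopology :: "'a function_space \<Rightarrow> ('a \<Rightarrow> complex) topology" where
  "htopology \<H> \<equiv> Metric_space.mtopology (elems \<H>) (hdist \<H>)"

locale hilbert_function_space =
  fixes \<H> :: "'a function_space"
  assumes vanishes_off_points: "f \<in> elems \<H> \<Longrightarrow> x \<notin> points \<H> \<Longrightarrow> f x = 0"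
    and subspace: "fun_space.subspace (elems \<H>)"
    and ip_add_left: "\<lbrakk>f \<in> elems \<H>; g \<in> elems \<H>; h \<in> elems \<H>\<rbrakk> \<Longrightarrow>
          ip \<H> (f + g) h = ip \<H> f h + ip \<H> g h"
    and ip_scale_left: "\<lbrakk>f \<in> elems \<H>; h \<in> elems \<H>\<rbrakk> \<Longrightarrow> ip \<H> (fscale c f) h = c * ip \<H> f h"
    and ip_cnj: "\<lbrakk>f \<in> elems \<H>; g \<in> elems \<H>\<rbrakk> \<Longrightarrow> ip \<H> g f = cnj (ip \<H> f g)"
    and ip_pos: "\<lbrakk>f \<in> elems \<H>; f \<noteq> 0\<rbrakk> \<Longrightarrow> Re (ip \<H> f f) > 0"
    and complete: "Metric_space.mcomplete (elems \<H>) (hdist \<H>)"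
    and continuous_eval: "x \<in> points \<H> \<Longrightarrow> continuous_map (htopology \<H>) euclidean (\<lambda>f. f x)"

definition reproducing_kernel :: "'a function_space \<Rightarrow> 'a \<Rightarrow> 'a \<Rightarrow> complex" where
  "reproducing_kernel \<H> x = (THE k. k \<in> elems \<H> \<and> (\<forall>f\<in>elems \<H>. f x = ip \<H> f k))"

definition set_of_uniqueness :: "'a function_space \<Rightarrow> 'a set \<Rightarrow> bool" where
  "set_of_uniqueness \<H> D \<longleftrightarrow>
     D \<subseteq> points \<H> \<and>
     (\<forall>f\<in>elems \<H>. \<forall>g\<in>elems \<H>. (\<forall>x\<in>D. f x = g x) \<longrightarrow> f = g)"

text \<open>A function \<open>\<phi> : D\<^sub>\<phi> \<rightarrow> \<complex>\<close> with \<open>D\<^sub>\<phi> \<subseteq> \<Omega>\<close> is a partial map with \<open>D\<^sub>\<phi> = dom \<phi>\<close>.\<close>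

definition pm_eq :: "('a \<rightharpoonup> complex) \<Rightarrow> ('a \<Rightarrow> complex) \<Rightarrow> ('a \<Rightarrow> complex) \<Rightarrow> bool" where
  "pm_eq \<phi> h g \<longleftrightarrow> (\<forall>x\<in>dom \<phi>. g x = the (\<phi> x) * h x)"

definition pm_dom :: "'a function_space \<Rightarrow> ('a \<rightharpoonup> complex) \<Rightarrow> ('a \<Rightarrow> complex) set" where
  "pm_dom \<H> \<phi> = {h \<in> elems \<H>. \<exists>g\<in>elems \<H>. pm_eq \<phi> h g}"

definition pm_op ::
    "'a function_space \<Rightarrow> ('a \<rightharpoonup> complex) \<Rightarrow> ('a \<Rightarrow> complex) \<Rightarrow> 'a \<Rightarrow> complex" where
  "pm_op \<H> \<phi> h = (THE g. g \<in> elems \<H> \<and> pm_eq \<phi> h g)"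

definition finite_codim :: "'a function_space \<Rightarrow> ('a \<Rightarrow> complex) set \<Rightarrow> bool" where
  "finite_codim \<H> E \<longleftrightarrow>
     (\<exists>B. finite B \<and> B \<subseteq> elems \<H> \<and> fun_space.span (E \<union> B) = elems \<H>)"

definition pseudomultiplier :: "'a function_space \<Rightarrow> ('a \<rightharpoonup> complex) \<Rightarrow> bool" where
  "pseudomultiplier \<H> \<phi> \<longleftrightarrow>
     set_of_uniqueness \<H> (dom \<phi>) \<and>
     closedin (htopology \<H>) (pm_dom \<H> \<phi>) \<and>
     finite_codim \<H> (pm_dom \<H> \<phi>)"

text \<open>
  The set \<open>\<Omega> \<union> {p}\<close> with \<open>p \<notin> \<Omega>\<close> is realised in \<^typ>\<open>'a option\<close>: \<^term>\<open>None\<close> is \<open>p\<close>, and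
  \<open>F \<circ> Some\<close> is the restriction of \<open>F\<close> to \<open>\<Omega>\<close>.
\<close>

definition extend_by ::
    "'a function_space \<Rightarrow> ('a \<Rightarrow> complex) \<Rightarrow> ('a \<Rightarrow> complex) \<Rightarrow> 'a option \<Rightarrow> complex" where
  "extend_by \<H> v f = (\<lambda>y. case y of Some x \<Rightarrow> f x | None \<Rightarrow> ip \<H> f v)"

definition extended_space ::
    "'a function_space \<Rightarrow> ('a \<Rightarrow> complex) \<Rightarrow> 'a option function_space" where
  "extended_space \<H> v =
     \<lparr>points = insert None (Some ` points \<H>),
      elems = extend_by \<H> v ` elems \<H>,
      ip = (\<lambda>F G. ip \<H> (F \<circ> Some) (G \<circ> Some))\<rparr>"

definition sees ::
    "'a function_space \<Rightarrow> ('a \<rightharpoonup> complex) \<Rightarrow> ('a \<Rightarrow> complex) \<Rightarrow> complex \<Rightarrow> bool" where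
  "sees \<H> \<phi> v c \<longleftrightarrow>
     (\<exists>\<psi>. pseudomultiplier (extended_space \<H> v) \<psi> \<and>
          Some ` dom \<phi> \<subseteq> dom \<psi> \<and>
          (\<forall>x\<in>dom \<phi>. \<psi> (Some x) = \<phi> x) \<and>
          pm_dom \<H> \<phi> = (\<lambda>F. F \<circ> Some) ` pm_dom (extended_space \<H> v) \<psi> \<and>
          \<psi> None = Some c)"

definition ambiguous_in_dom :: "'a function_space \<Rightarrow> ('a \<rightharpoonup> complex) \<Rightarrow> 'a \<Rightarrow> bool" where
  "ambiguous_in_dom \<H> \<phi> \<alpha> \<longleftrightarrow>
     \<alpha> \<in> dom \<phi> \<and>
     (\<exists>c. c \<noteq> the (\<phi> \<alpha>) \<and>
          pm_dom \<H> \<phi> = pm_dom \<H> (\<phi>(\<alpha> \<mapsto> c)) \<and>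
          (\<forall>h\<in>pm_dom \<H> \<phi>. pm_op \<H> (\<phi>(\<alpha> \<mapsto> c)) h = pm_op \<H> \<phi> h))"

definition ambiguous_point :: "'a function_space \<Rightarrow> ('a \<rightharpoonup> complex) \<Rightarrow> 'a \<Rightarrow> bool" where
  "ambiguous_point \<H> \<phi> \<alpha> \<longleftrightarrow>
     ambiguous_in_dom \<H> \<phi> \<alpha> \<or>
     \<alpha> \<in> points \<H> - dom \<phi> \<and>
       (\<exists>c. sees \<H> \<phi> (reproducing_kernel \<H> \<alpha>) c \<and> ambiguous_in_dom \<H> (\<phi>(\<alpha> \<mapsto> c)) \<alpha>)"

end

theory Submission
  imports Defs
begin

text \<open>
  Everything is read off the graph of \<open>X\<^sub>\<phi>\<close>, the set of pairs \<open>(h, g)\<close> in \<open>\<H> \<times> \<H>\<close> with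
  \<open>g = \<phi> h\<close> on \<open>D\<^sub>\<phi>\<close>. Both notions of the theorem turn out to be equivalent to one condition:
  \<open>h(\<alpha>) = g(\<alpha>) = 0\<close> for every \<open>(h, g)\<close> in the graph.

  Seeing. If \<open>\<psi>\<close> witnesses that \<open>\<phi>\<close> sees \<open>v\<close> with value \<open>c\<close>, then for \<open>h \<in> E\<^sub>\<phi>\<close> the extension \<open>h\<^sub>v\<close>
  lies in \<open>E\<^sub>\<psi>\<close>, its image under \<open>X\<^sub>\<psi>\<close> restricts to \<open>X\<^sub>\<phi> h\<close>, and evaluation at the new point gives
  \<open>\<langle>X\<^sub>\<phi> h, v\<rangle> = c \<langle>h, v\<rangle>\<close>. Conversely, if this identity holds on \<open>E\<^sub>\<phi>\<close>, then \<open>\<phi>\<close> extended by the value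
  \<open>c\<close> at the new point is a witness (\<open>sees_iff_graph\<close>). For \<open>v = k\<^sub>\<alpha>\<close> the identity reads
  \<open>g(\<alpha>) = c h(\<alpha>)\<close>, and two different values of \<open>c\<close> force both sides to vanish
  (\<open>sees_arbitrary_iff_graph_vanishes\<close>).

  Ambiguity. For \<open>\<alpha> \<in> D\<^sub>\<phi>\<close>, ambiguity says that replacing the value \<open>\<phi>(\<alpha>)\<close> by some other \<open>c\<close> does
  not change the graph (\<open>ambiguous_in_dom_iff_graph\<close>), so \<open>\<phi>(\<alpha>) h(\<alpha>) = g(\<alpha>) = c h(\<alpha>)\<close> and both
  vanish. The converse is the delicate step: dropping the condition at \<open>\<alpha>\<close> may enlarge the graph,
  but the values \<open>(h(\<alpha>), g(\<alpha>))\<close> on the larger graph form a subspace of \<open>\<complex>\<^sup>2\<close> that meets the line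
  through \<open>(1, \<phi>(\<alpha>))\<close> only in zero, hence has dimension at most one. So it meets the line through
  \<open>(1, c)\<close> nontrivially for at most one \<open>c\<close>, and any other \<open>c \<noteq> \<phi>(\<alpha>)\<close> shows that \<open>\<alpha>\<close> is ambiguous
  (\<open>ambiguous_in_dom_iff_graph_vanishes\<close>). For \<open>\<alpha> \<notin> D\<^sub>\<phi>\<close>, seeing \<open>k\<^sub>\<alpha>\<close> with value \<open>c\<close> says that
  adjoining the value \<open>c\<close> at \<open>\<alpha>\<close> leaves the graph unchanged, so ambiguity of the enlarged function
  is again the vanishing condition.

  The kernel \<open>k\<^sub>\<alpha>\<close> has to be shown to exist; this is the Riesz representation theorem for point
  evaluations, obtained from an element of minimal norm among those with value 1 at the point.
\<close>

section \<open>The norm of a Hilbert function space\<close>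

text \<open>
  For small \<open>t\<close> the linear term dominates, so it must be absent. This is what turns minimality of the
  norm along a line into orthogonality.
\<close>

lemma linear_coefficient_zero:
  fixes b s :: real
  assumes "\<And>t. 0 \<le> 2 * t * b + t\<^sup>2 * s"
  shows "b = 0"
proof (rule ccontr)
  assume "b \<noteq> 0"
  define r where "r = \<bar>s\<bar> + 1"
  \<comment> \<open>\<open>r\<close> is large enough that the step \<open>- b / r\<close> stays in the range where the linear term wins.\<close>
  have r: "r > 0" "s < 2 * r" by (auto simp: r_def)
  have "0 \<le> 2 * (- b / r) * b + (- b / r)\<^sup>2 * s" by (rule assms)
  also have "\<dots> = (b\<^sup>2 / r\<^sup>2) * (s - 2 * r)"
    using r by (simp add: field_simps power2_eq_square)
  also have "\<dots> < 0"
    using r \<open>b \<noteq> 0\<close> by (intro mult_pos_neg) auto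
  finally show False by simp
qed

context hilbert_function_space
begin

abbreviation norm_sq :: "('a \<Rightarrow> complex) \<Rightarrow> real" where
  "norm_sq f \<equiv> Re (ip \<H> f f)"

lemma elems_closed:
  shows "0 \<in> elems \<H>"
    and "f \<in> elems \<H> \<Longrightarrow> g \<in> elems \<H> \<Longrightarrow> f + g \<in> elems \<H>"
    and "f \<in> elems \<H> \<Longrightarrow> g \<in> elems \<H> \<Longrightarrow> f - g \<in> elems \<H>"
    and "f \<in> elems \<H> \<Longrightarrow> fscale c f \<in> elems \<H>"
  using subspace
  by (auto intro: fun_space.subspace_0 fun_space.subspace_add fun_space.subspace_diff
      fun_space.subspace_scale)

lemma diff_eq_add_scale: "f - g = f + fscale (- 1) g" for f g :: "'a \<Rightarrow> complex"
  by (auto simp: fun_eq_iff fscale_def)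

lemma ip_diff_left:
  "\<lbrakk>f \<in> elems \<H>; g \<in> elems \<H>; h \<in> elems \<H>\<rbrakk> \<Longrightarrow> ip \<H> (f - g) h = ip \<H> f h - ip \<H> g h"
  unfolding diff_eq_add_scale
  by (simp only: ip_add_left ip_scale_left elems_closed) simp

lemma ip_add_right:
  assumes "f \<in> elems \<H>" "g \<in> elems \<H>" "h \<in> elems \<H>"
  shows "ip \<H> h (f + g) = ip \<H> h f + ip \<H> h g"
proof -
  have "ip \<H> h (f + g) = cnj (ip \<H> (f + g) h)"
    using assms by (intro ip_cnj elems_closed)
  also have "\<dots> = cnj (ip \<H> f h) + cnj (ip \<H> g h)"
    using assms by (simp add: ip_add_left)
  also have "\<dots> = ip \<H> h f + ip \<H> h g"
    using assms ip_cnj[of f h] ip_cnj[of g h] by simp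
  finally show ?thesis .
qed

lemma ip_scale_right:
  assumes "f \<in> elems \<H>" "h \<in> elems \<H>"
  shows "ip \<H> h (fscale c f) = cnj c * ip \<H> h f"
proof -
  have "ip \<H> h (fscale c f) = cnj (ip \<H> (fscale c f) h)"
    using assms by (intro ip_cnj elems_closed)
  also have "\<dots> = cnj c * cnj (ip \<H> f h)"
    using assms by (simp add: ip_scale_left)
  also have "\<dots> = cnj c * ip \<H> h f"
    using assms ip_cnj[of f h] by simp
  finally show ?thesis .
qed

lemma ip_zero_left: "h \<in> elems \<H> \<Longrightarrow> ip \<H> 0 h = 0"
  using ip_diff_left[of h h h] by simp

lemma norm_sq_nonneg: "f \<in> elems \<H> \<Longrightarrow> 0 \<le> norm_sq f"
  using ip_pos[of f] ip_zero_left[of f] by (cases "f = 0") auto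

lemma norm_sq_eq_0: "f \<in> elems \<H> \<Longrightarrow> norm_sq f = 0 \<longleftrightarrow> f = 0"
  using ip_pos[of f] ip_zero_left[of f] by (cases "f = 0") auto

lemma ip_self_real: "f \<in> elems \<H> \<Longrightarrow> ip \<H> f f = of_real (norm_sq f)"
  using ip_cnj[of f f] by (auto simp: complex_eq_iff)

lemma norm_sq_add_scale:
  assumes "f \<in> elems \<H>" "g \<in> elems \<H>"
  shows "norm_sq (f + fscale c g) = norm_sq f + 2 * Re (c * ip \<H> g f) + (cmod c)\<^sup>2 * norm_sq g"
proof -
  have "ip \<H> (f + fscale c g) (f + fscale c g) =
      ip \<H> f f + c * ip \<H> g f + cnj c * cnj (ip \<H> g f) + c * cnj c * ip \<H> g g"
    using assms ip_cnj[of g f]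
    by (simp add: ip_add_left ip_add_right ip_scale_left ip_scale_right elems_closed algebra_simps)
  moreover have "Re (c * cnj c * ip \<H> g g) = (cmod c)\<^sup>2 * norm_sq g"
    by (simp only: complex_norm_square[symmetric]) simp
  ultimately show ?thesis
    by simp
qed

lemma norm_sq_add_real_scale:
  assumes "f \<in> elems \<H>" "g \<in> elems \<H>"
  shows "norm_sq (f + fscale (of_real t) g) = norm_sq f + 2 * t * Re (ip \<H> g f) + t\<^sup>2 * norm_sq g"
  using norm_sq_add_scale[OF assms, of "of_real t"] by simp

lemma norm_sq_minus_commute:
  assumes "f \<in> elems \<H>" "g \<in> elems \<H>"
  shows "norm_sq (f - g) = norm_sq (g - f)"
proof -
  have d: "g - f \<in> elems \<H>" using assms by (simp add: elems_closed)
  have "f - g = fscale (- 1) (g - f)"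
    by (auto simp: fun_eq_iff fscale_def)
  then have "ip \<H> (f - g) (f - g) = - 1 * (cnj (- 1) * ip \<H> (g - f) (g - f))"
    by (simp only: ip_scale_left[OF d elems_closed(4)[OF d]] ip_scale_right[OF d d])
  then show ?thesis by simp
qed

lemma Cauchy_Schwarz:
  assumes "f \<in> elems \<H>" "g \<in> elems \<H>"
  shows "(Re (ip \<H> g f))\<^sup>2 \<le> norm_sq f * norm_sq g"
proof (cases "g = 0")
  case True
  then show ?thesis using assms by (simp add: ip_zero_left)
next
  case False
  define b where "b = Re (ip \<H> g f)"
  have s: "norm_sq g > 0" using False assms ip_pos by blast
  \<comment> \<open>The parameter \<open>- b / \<parallel>g\<parallel>\<^sup>2\<close> minimises \<open>t \<mapsto> \<parallel>f + t g\<parallel>\<^sup>2\<close>.\<close>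
  have "0 \<le> norm_sq (f + fscale (of_real (- b / norm_sq g)) g)"
    using assms by (intro norm_sq_nonneg elems_closed)
  also have "\<dots> = norm_sq f - b\<^sup>2 / norm_sq g"
    unfolding norm_sq_add_real_scale[OF assms] b_def[symmetric]
    using s by (simp add: field_simps power2_eq_square)
  finally show ?thesis
    using s by (simp add: field_simps b_def)
qed

lemma norm_triangle:
  assumes "f \<in> elems \<H>" "g \<in> elems \<H>"
  shows "sqrt (norm_sq (f + g)) \<le> sqrt (norm_sq f) + sqrt (norm_sq g)"
proof (rule real_le_lsqrt)
  have "norm_sq (f + g) = norm_sq f + 2 * Re (ip \<H> g f) + norm_sq g"
    using norm_sq_add_real_scale[OF assms, of 1] by (simp add: fscale_def)
  moreover have "\<bar>Re (ip \<H> g f)\<bar> \<le> sqrt (norm_sq f) * sqrt (norm_sq g)"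
    using real_sqrt_le_mono[OF Cauchy_Schwarz[OF assms]] by (simp add: real_sqrt_mult)
  ultimately show "norm_sq (f + g) \<le> (sqrt (norm_sq f) + sqrt (norm_sq g))\<^sup>2"
    using norm_sq_nonneg[OF assms(1)] norm_sq_nonneg[OF assms(2)]
    by (simp add: power2_sum)
qed (use assms norm_sq_nonneg in auto)

sublocale Metric_space "elems \<H>" "hdist \<H>"
proof
  show "0 \<le> hdist \<H> f g" for f g
    by (auto simp: hdist_def intro: norm_sq_nonneg elems_closed)
  show "hdist \<H> f g = hdist \<H> g f" for f g
    using norm_sq_minus_commute[of f g] by (auto simp: hdist_def)
  show "hdist \<H> f g = 0 \<longleftrightarrow> f = g" if "f \<in> elems \<H>" "g \<in> elems \<H>" for f g
    using that norm_sq_eq_0[of "f - g"] by (simp add: hdist_def elems_closed)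
  show "hdist \<H> f h \<le> hdist \<H> f g + hdist \<H> g h"
    if "f \<in> elems \<H>" "g \<in> elems \<H>" "h \<in> elems \<H>" for f g h
    using that norm_triangle[of "f - g" "g - h"] by (simp add: hdist_def elems_closed)
qed


section \<open>The reproducing kernel\<close>

text \<open>
  A minimising sequence is Cauchy because the midpoint of two of its members is again a competitor,
  so the parallelogram law bounds their distance; its limit is a competitor because evaluation is
  continuous.
\<close>

lemma minimal_norm_element:
  assumes x: "x \<in> points \<H>" and f0: "f0 \<in> elems \<H>" "f0 x = 1"
  obtains l where "l \<in> elems \<H>" "l x = 1"
    "\<And>f. \<lbrakk>f \<in> elems \<H>; f x = 1\<rbrakk> \<Longrightarrow> norm_sq l \<le> norm_sq f"
proof -
  define A where "A = {f \<in> elems \<H>. f x = 1}"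
  define m where "m = Inf (norm_sq ` A)"
  have bdd: "bdd_below (norm_sq ` A)"
    unfolding A_def by (intro bdd_belowI[of _ 0]) (auto intro: norm_sq_nonneg)
  have m_le: "m \<le> norm_sq f" if "f \<in> A" for f
    unfolding m_def using that bdd by (simp add: cInf_lower)
  have "\<exists>f\<in>A. norm_sq f < m + 1 / real (Suc n)" for n
  proof -
    have "\<exists>y\<in>norm_sq ` A. y < m + 1 / real (Suc n)"
      using cInf_lessD[of "norm_sq ` A" "m + 1 / real (Suc n)"] f0 by (auto simp: m_def A_def)
    then show ?thesis by auto
  qed
  then obtain \<sigma> where \<sigma>: "\<And>n. \<sigma> n \<in> A" "\<And>n. norm_sq (\<sigma> n) < m + 1 / real (Suc n)"
    by metis
  then have \<sigma>H: "\<sigma> n \<in> elems \<H>" for n by (auto simp: A_def)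
  have parallelogram: "norm_sq (f - g) \<le> 2 * norm_sq f + 2 * norm_sq g - 4 * m"
    if "f \<in> A" "g \<in> A" for f g
  proof -
    have fg: "f \<in> elems \<H>" "g \<in> elems \<H>" using that by (auto simp: A_def)
    define d where "d = g - f"
    have d: "d \<in> elems \<H>" using fg by (simp add: d_def elems_closed)
    have mid: "f + fscale (of_real (1 / 2)) d \<in> A"
      unfolding A_def
    proof (intro CollectI conjI)
      show "f + fscale (of_real (1 / 2)) d \<in> elems \<H>"
        using fg d by (intro elems_closed)
      show "(f + fscale (of_real (1 / 2)) d) x = 1"
        using that by (simp add: A_def d_def fscale_def)
    qed
    have "g = f + fscale (of_real 1) d" by (simp add: d_def fscale_def fun_eq_iff)
    then have "norm_sq g = norm_sq f + 2 * Re (ip \<H> d f) + norm_sq d"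
      using norm_sq_add_real_scale[OF fg(1) d, of 1] by simp
    moreover have "m \<le> norm_sq f + Re (ip \<H> d f) + norm_sq d / 4"
      using m_le[OF mid] unfolding norm_sq_add_real_scale[OF fg(1) d]
      by (simp add: power2_eq_square)
    moreover have "norm_sq (f - g) = norm_sq d"
      unfolding d_def by (rule norm_sq_minus_commute[OF fg])
    ultimately show ?thesis by simp
  qed
  have "MCauchy \<sigma>"
    unfolding MCauchy_def
  proof (intro conjI allI impI)
    show "range \<sigma> \<subseteq> elems \<H>" using \<sigma>H by auto
    fix e :: real assume "e > 0"
    then obtain N where N: "inverse (real (Suc N)) < e\<^sup>2 / 4"
      using reals_Archimedean[of "e\<^sup>2 / 4"] by auto
    have close: "hdist \<H> (\<sigma> n) (\<sigma> k) < e" if "N \<le> n" "N \<le> k" for n k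
    proof -
      have le: "1 / real (Suc i) \<le> inverse (real (Suc N))" if "N \<le> i" for i
        using that by (simp add: field_simps)
      have "norm_sq (\<sigma> n - \<sigma> k) \<le> 2 * norm_sq (\<sigma> n) + 2 * norm_sq (\<sigma> k) - 4 * m"
        by (rule parallelogram[OF \<sigma>(1) \<sigma>(1)])
      also have "\<dots> < e\<^sup>2"
        using \<sigma>(2)[of n] \<sigma>(2)[of k] le[OF that(1)] le[OF that(2)] N by linarith
      finally have "sqrt (norm_sq (\<sigma> n - \<sigma> k)) < sqrt (e\<^sup>2)"
        by (rule real_sqrt_less_mono)
      then show ?thesis using \<sigma>H \<open>e > 0\<close> by (simp add: hdist_def)
    qed
    show "\<exists>N. \<forall>n n'. N \<le> n \<longrightarrow> N \<le> n' \<longrightarrow> hdist \<H> (\<sigma> n) (\<sigma> n') < e"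
      using close by blast
  qed
  then obtain l where l: "limitin mtopology \<sigma> l sequentially"
    using complete unfolding mcomplete_def by blast
  then have lH: "l \<in> elems \<H>" by (simp add: limit_metric_sequentially)
  have "(\<lambda>n. \<sigma> n x) \<longlonglongrightarrow> l x"
    using continuous_map_limit[OF continuous_eval[OF x] l] by (simp add: o_def)
  then have lx: "l x = 1"
    using \<sigma>(1) by (simp add: A_def LIMSEQ_const_iff)
  have dist_lim: "(\<lambda>n. hdist \<H> (\<sigma> n) l) \<longlonglongrightarrow> 0"
    using l unfolding limit_metric_sequentially lim_sequentially dist_real_def
    by simp blast
  have "(\<lambda>n. hdist \<H> (\<sigma> n) l + sqrt (m + 1 / real (Suc n))) \<longlonglongrightarrow> 0 + sqrt (m + 0)"
    by (intro tendsto_intros dist_lim LIMSEQ_inverse_real_of_nat[unfolded inverse_eq_divide])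
  moreover have "sqrt (norm_sq l) \<le> hdist \<H> (\<sigma> n) l + sqrt (m + 1 / real (Suc n))" for n
  proof -
    have "sqrt (norm_sq l) \<le> sqrt (norm_sq (l - \<sigma> n)) + sqrt (norm_sq (\<sigma> n))"
      using norm_triangle[of "l - \<sigma> n" "\<sigma> n"] lH \<sigma>H by (simp add: elems_closed)
    moreover have "sqrt (norm_sq (l - \<sigma> n)) = hdist \<H> (\<sigma> n) l"
      using lH \<sigma>H[of n] norm_sq_minus_commute[of l "\<sigma> n"] by (simp add: hdist_def)
    moreover have "sqrt (norm_sq (\<sigma> n)) \<le> sqrt (m + 1 / real (Suc n))"
      using \<sigma>(2)[of n] by (intro real_sqrt_le_mono) simp
    ultimately show ?thesis by linarith
  qed
  ultimately have "sqrt (norm_sq l) \<le> 0 + sqrt (m + 0)"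
    by (intro LIMSEQ_le_const) auto
  then have lm: "norm_sq l \<le> m" by simp
  show thesis
  proof (rule that[OF lH lx])
    fix f assume "f \<in> elems \<H>" "f x = 1"
    then have "f \<in> A" by (simp add: A_def)
    from m_le[OF this] lm show "norm_sq l \<le> norm_sq f" by linarith
  qed
qed

text \<open>
  The minimiser \<open>l\<close> is orthogonal to the kernel of evaluation at \<open>x\<close>, because moving along that
  kernel stays among the competitors; since \<open>f - f(x) l\<close> lies in the kernel, \<open>l / \<parallel>l\<parallel>\<^sup>2\<close> represents
  evaluation.
\<close>

lemma evaluation_representable:
  assumes x: "x \<in> points \<H>"
  shows "\<exists>k\<in>elems \<H>. \<forall>f\<in>elems \<H>. f x = ip \<H> f k"
proof (cases "\<forall>f\<in>elems \<H>. f x = 0")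
  case True
  have "\<forall>f\<in>elems \<H>. f x = ip \<H> f 0"
    using True ip_cnj[OF elems_closed(1)] by (simp add: ip_zero_left)
  then show ?thesis using elems_closed(1) by blast
next
  case False
  then obtain f1 where f1: "f1 \<in> elems \<H>" "f1 x \<noteq> 0" by blast
  have "fscale (1 / f1 x) f1 \<in> elems \<H>" "fscale (1 / f1 x) f1 x = 1"
    using elems_closed(4)[OF f1(1)] f1(2) by (blast, simp add: fscale_def)
  then obtain l where l: "l \<in> elems \<H>" "l x = 1"
    and min: "\<And>f. \<lbrakk>f \<in> elems \<H>; f x = 1\<rbrakk> \<Longrightarrow> norm_sq l \<le> norm_sq f"
    using minimal_norm_element[OF x] by blast
  have Re0: "Re (ip \<H> f l) = 0" if "f \<in> elems \<H>" "f x = 0" for f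
  proof (rule linear_coefficient_zero)
    fix t :: real
    have "norm_sq l \<le> norm_sq (l + fscale (of_real t) f)"
      using that l by (intro min elems_closed) (auto simp: fscale_def)
    then show "0 \<le> 2 * t * Re (ip \<H> f l) + t\<^sup>2 * norm_sq f"
      unfolding norm_sq_add_real_scale[OF l(1) that(1)] by simp
  qed
  have orth: "ip \<H> f l = 0" if "f \<in> elems \<H>" "f x = 0" for f
  proof -
    have "Re (ip \<H> (fscale \<i> f) l) = 0"
      using that by (intro Re0 elems_closed) (auto simp: fscale_def)
    then show ?thesis
      using Re0[OF that] that l by (simp add: ip_scale_left complex_eq_iff)
  qed
  have "l \<noteq> 0" using l(2) by auto
  then have pos: "norm_sq l > 0" using l ip_pos by blast
  define k where "k = fscale (of_real (1 / norm_sq l)) l"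
  have "k \<in> elems \<H>" unfolding k_def using l by (intro elems_closed)
  moreover have "f x = ip \<H> f k" if f: "f \<in> elems \<H>" for f
  proof -
    have "ip \<H> (f - fscale (f x) l) l = 0"
      using f l by (intro orth elems_closed) (auto simp: fscale_def)
    then have "ip \<H> f l = f x * ip \<H> l l"
      using f l by (simp add: ip_diff_left ip_scale_left elems_closed)
    moreover have "ip \<H> f k = of_real (1 / norm_sq l) * ip \<H> f l"
      unfolding k_def using f l by (simp only: ip_scale_right complex_cnj_complex_of_real)
    moreover have "of_real (1 / norm_sq l) * ip \<H> l l = 1"
      using pos by (subst ip_self_real[OF l(1)]) (simp flip: of_real_mult)
    ultimately show ?thesis by (metis mult.left_commute mult.right_neutral)
  qed
  ultimately show ?thesis by blast
qed

lemma reproducing_kernel: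
  assumes "x \<in> points \<H>"
  shows "reproducing_kernel \<H> x \<in> elems \<H>"
    and "f \<in> elems \<H> \<Longrightarrow> ip \<H> f (reproducing_kernel \<H> x) = f x"
proof -
  have "\<exists>!k. k \<in> elems \<H> \<and> (\<forall>f\<in>elems \<H>. f x = ip \<H> f k)"
  proof (rule ex_ex1I)
    show "\<exists>k. k \<in> elems \<H> \<and> (\<forall>f\<in>elems \<H>. f x = ip \<H> f k)"
      using evaluation_representable[OF assms] by blast
  next
    fix k l
    assume k: "k \<in> elems \<H> \<and> (\<forall>f\<in>elems \<H>. f x = ip \<H> f k)"
      and l: "l \<in> elems \<H> \<and> (\<forall>f\<in>elems \<H>. f x = ip \<H> f l)"
    define d where "d = k - l"
    have d: "d \<in> elems \<H>" using k l by (simp add: d_def elems_closed)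
    have "ip \<H> k d = ip \<H> l d"
      using k l d ip_cnj[of d k] ip_cnj[of d l] by metis
    then have "ip \<H> d d = 0"
      using k l d ip_diff_left[of k l d] by (simp add: d_def)
    then have "d = 0" using norm_sq_eq_0[OF d] by simp
    then show "k = l" by (simp add: d_def)
  qed
  from theI'[OF this]
  have K: "reproducing_kernel \<H> x \<in> elems \<H> \<and>
      (\<forall>f\<in>elems \<H>. f x = ip \<H> f (reproducing_kernel \<H> x))"
    unfolding reproducing_kernel_def .
  then show "reproducing_kernel \<H> x \<in> elems \<H>" by blast
  show "ip \<H> f (reproducing_kernel \<H> x) = f x" if "f \<in> elems \<H>" using K that by simp
qed

end


section \<open>The graph of a pseudomultiplier\<close>

definition pm_graph ::
    "'a function_space \<Rightarrow> ('a \<rightharpoonup> complex) \<Rightarrow> (('a \<Rightarrow> complex) \<times> ('a \<Rightarrow> complex)) set" where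
  "pm_graph \<H> \<phi> = {(h, g). h \<in> elems \<H> \<and> g \<in> elems \<H> \<and> pm_eq \<phi> h g}"

definition graph_vanishes_at :: "'a function_space \<Rightarrow> ('a \<rightharpoonup> complex) \<Rightarrow> 'a \<Rightarrow> bool" where
  "graph_vanishes_at \<H> \<phi> \<alpha> \<longleftrightarrow> (\<forall>(h, g)\<in>pm_graph \<H> \<phi>. h \<alpha> = 0 \<and> g \<alpha> = 0)"

lemma pm_dom_eq_Domain: "pm_dom \<H> \<phi> = Domain (pm_graph \<H> \<phi>)"
  by (auto simp: pm_dom_def pm_graph_def)

lemma graph_unique:
  assumes "set_of_uniqueness \<H> (dom \<phi>)" "(h, g) \<in> pm_graph \<H> \<phi>" "(h, g') \<in> pm_graph \<H> \<phi>"
  shows "g = g'"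
  using assms by (auto simp: set_of_uniqueness_def pm_graph_def pm_eq_def)

lemma pm_op_eq:
  assumes "set_of_uniqueness \<H> (dom \<phi>)" "(h, g) \<in> pm_graph \<H> \<phi>"
  shows "pm_op \<H> \<phi> h = g"
  unfolding pm_op_def
proof (rule the_equality)
  show "g \<in> elems \<H> \<and> pm_eq \<phi> h g" using assms(2) by (auto simp: pm_graph_def)
next
  fix g' assume "g' \<in> elems \<H> \<and> pm_eq \<phi> h g'"
  then show "g' = g"
    using assms graph_unique[of \<H> \<phi> h g' g] by (auto simp: pm_graph_def)
qed

lemma operators_agree_iff_graph:
  assumes U: "set_of_uniqueness \<H> (dom \<phi>)" and V: "set_of_uniqueness \<H> (dom \<psi>)"
  shows "(pm_dom \<H> \<phi> = pm_dom \<H> \<psi> \<and> (\<forall>h\<in>pm_dom \<H> \<phi>. pm_op \<H> \<psi> h = pm_op \<H> \<phi> h)) \<longleftrightarrow>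
    pm_graph \<H> \<psi> = pm_graph \<H> \<phi>" (is "?L \<longleftrightarrow> ?R")
proof
  have *: "(h, g) \<in> pm_graph \<H> \<theta> \<longleftrightarrow> h \<in> pm_dom \<H> \<theta> \<and> g = pm_op \<H> \<theta> h"
    if "set_of_uniqueness \<H> (dom \<theta>)" for \<theta> h g
    using pm_op_eq[OF that] unfolding pm_dom_eq_Domain by blast
  show ?R if ?L
    using that *[OF U] *[OF V] by auto
  show ?L if R: ?R
  proof -
    have "pm_op \<H> \<psi> h = pm_op \<H> \<phi> h" if "(h, g) \<in> pm_graph \<H> \<phi>" for h g
      using pm_op_eq[OF U that] pm_op_eq[OF V, of h g] that R by simp
    then show ?thesis using R unfolding pm_dom_eq_Domain by auto
  qed
qed

lemma ambiguous_in_dom_iff_graph: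
  assumes "set_of_uniqueness \<H> (dom \<phi>)"
  shows "ambiguous_in_dom \<H> \<phi> \<alpha> \<longleftrightarrow>
    \<alpha> \<in> dom \<phi> \<and> (\<exists>c. c \<noteq> the (\<phi> \<alpha>) \<and> pm_graph \<H> (\<phi>(\<alpha> \<mapsto> c)) = pm_graph \<H> \<phi>)"
proof -
  have "set_of_uniqueness \<H> (dom (\<phi>(\<alpha> \<mapsto> c)))" if "\<alpha> \<in> dom \<phi>" for c
    using assms that by (simp add: insert_absorb)
  then show ?thesis
    unfolding ambiguous_in_dom_def
    using operators_agree_iff_graph[OF assms] by blast
qed

lemma graph_update:
  "(h, g) \<in> pm_graph \<H> (\<phi>(\<alpha> \<mapsto> c)) \<longleftrightarrow>
    h \<in> elems \<H> \<and> g \<in> elems \<H> \<and> g \<alpha> = c * h \<alpha> \<and>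
    (\<forall>x\<in>dom \<phi> - {\<alpha>}. g x = the (\<phi> x) * h x)"
  by (auto simp: pm_graph_def pm_eq_def)

text \<open>
  The two graphs differ only in the identity imposed at \<open>\<alpha>\<close>, and where \<open>h\<close> and \<open>g\<close> both vanish that
  identity holds for every value of the multiplier.
\<close>

lemma graph_subset_update:
  assumes "graph_vanishes_at \<H> \<phi> \<alpha>"
  shows "pm_graph \<H> \<phi> \<subseteq> pm_graph \<H> (\<phi>(\<alpha> \<mapsto> c))"
proof (intro subsetI, clarify)
  fix h g assume hg: "(h, g) \<in> pm_graph \<H> \<phi>"
  then have "h \<alpha> = 0 \<and> g \<alpha> = 0" using assms by (auto simp: graph_vanishes_at_def)
  then show "(h, g) \<in> pm_graph \<H> (\<phi>(\<alpha> \<mapsto> c))"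
    using hg unfolding graph_update by (simp add: pm_graph_def pm_eq_def)
qed

text \<open>
  Conversely, if \<open>h(\<alpha>) = 0\<close> then \<open>g(\<alpha>) = c h(\<alpha>) = 0\<close>, and the identity with \<open>\<phi>(\<alpha>)\<close> holds as well.
  So whatever the update adds to the graph can be normalised to the value 1 at \<open>\<alpha>\<close>.
\<close>

lemma new_in_updated_graph:
  assumes "(h, g) \<in> pm_graph \<H> (\<phi>(\<alpha> \<mapsto> c)) - pm_graph \<H> \<phi>"
  shows "h \<alpha> \<noteq> 0"
proof
  assume "h \<alpha> = 0"
  with assms have "g x = the (\<phi> x) * h x" if "x \<in> dom \<phi>" for x
    using that unfolding Diff_iff graph_update by (cases "x = \<alpha>") auto
  then show False
    using assms unfolding Diff_iff graph_update by (auto simp: pm_graph_def pm_eq_def)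
qed

text \<open>
  Two values \<open>c\<close> that both enlarge the graph would yield \<open>(1, \<phi>(\<alpha>))\<close> as a combination of
  \<open>(1, \<phi>(\<alpha>) + 1)\<close> and \<open>(1, \<phi>(\<alpha>) + 2)\<close>, that is, a pair of the original graph not vanishing at \<open>\<alpha>\<close>.
\<close>

lemma ambiguous_in_dom_iff_graph_vanishes:
  assumes H: "hilbert_function_space \<H>" and U: "set_of_uniqueness \<H> (dom \<phi>)"
    and \<alpha>: "\<alpha> \<in> dom \<phi>"
  shows "ambiguous_in_dom \<H> \<phi> \<alpha> \<longleftrightarrow> graph_vanishes_at \<H> \<phi> \<alpha>"
proof
  assume "ambiguous_in_dom \<H> \<phi> \<alpha>"
  then obtain c where c: "c \<noteq> the (\<phi> \<alpha>)" "pm_graph \<H> (\<phi>(\<alpha> \<mapsto> c)) = pm_graph \<H> \<phi>"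
    using ambiguous_in_dom_iff_graph[OF U] by blast
  have "h \<alpha> = 0 \<and> g \<alpha> = 0" if "(h, g) \<in> pm_graph \<H> \<phi>" for h g
  proof -
    have "g \<alpha> = the (\<phi> \<alpha>) * h \<alpha>" using that \<alpha> by (auto simp: pm_graph_def pm_eq_def)
    moreover have "g \<alpha> = c * h \<alpha>" using that c(2) graph_update[of h g \<H> \<phi> \<alpha> c] by simp
    ultimately show ?thesis using c(1) by auto
  qed
  then show "graph_vanishes_at \<H> \<phi> \<alpha>" by (auto simp: graph_vanishes_at_def)
next
  interpret hilbert_function_space \<H> by fact
  assume Z: "graph_vanishes_at \<H> \<phi> \<alpha>"
  define p where "p = the (\<phi> \<alpha>)"
  have "\<exists>c. c \<noteq> p \<and> pm_graph \<H> (\<phi>(\<alpha> \<mapsto> c)) = pm_graph \<H> \<phi>"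
  proof (rule ccontr)
    assume "\<not> ?thesis"
    then have "pm_graph \<H> (\<phi>(\<alpha> \<mapsto> p + 1)) \<noteq> pm_graph \<H> \<phi>"
      and "pm_graph \<H> (\<phi>(\<alpha> \<mapsto> p + 2)) \<noteq> pm_graph \<H> \<phi>"
      by (metis add_cancel_left_right one_neq_zero zero_neq_numeral)+
    with graph_subset_update[OF Z] obtain h1 g1 h2 g2
      where *: "(h1, g1) \<in> pm_graph \<H> (\<phi>(\<alpha> \<mapsto> p + 1)) - pm_graph \<H> \<phi>"
        "(h2, g2) \<in> pm_graph \<H> (\<phi>(\<alpha> \<mapsto> p + 2)) - pm_graph \<H> \<phi>"
      by fast
    note nz = new_in_updated_graph[OF *(1)] new_in_updated_graph[OF *(2)]
    note upd = *[THEN DiffD1, unfolded graph_update]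
    define h where "h = fscale (2 / h1 \<alpha>) h1 - fscale (1 / h2 \<alpha>) h2"
    define g where "g = fscale (2 / h1 \<alpha>) g1 - fscale (1 / h2 \<alpha>) g2"
    have "h \<in> elems \<H>" "g \<in> elems \<H>"
      using upd by (auto simp: h_def g_def intro!: elems_closed)
    moreover have h\<alpha>: "h \<alpha> = 1" and "g \<alpha> = p"
      using upd nz by (auto simp: h_def g_def fscale_def)
    moreover have "g x = the (\<phi> x) * h x" if "x \<in> dom \<phi> - {\<alpha>}" for x
    proof -
      have "g1 x = the (\<phi> x) * h1 x" "g2 x = the (\<phi> x) * h2 x" using upd that by blast+
      then show ?thesis by (simp add: h_def g_def fscale_def algebra_simps)
    qed
    ultimately have "(h, g) \<in> pm_graph \<H> (\<phi>(\<alpha> \<mapsto> p))"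
      unfolding graph_update by simp
    moreover have "\<phi>(\<alpha> \<mapsto> p) = \<phi>"
      using \<alpha> by (auto simp: p_def)
    ultimately have "(h, g) \<in> pm_graph \<H> \<phi>" by simp
    then show False using Z h\<alpha> by (auto simp: graph_vanishes_at_def)
  qed
  then show "ambiguous_in_dom \<H> \<phi> \<alpha>"
    using ambiguous_in_dom_iff_graph[OF U] \<alpha> by (simp add: p_def)
qed


section \<open>Seeing a vector\<close>

lemma extend_by_comp_Some [simp]: "extend_by \<H> v f \<circ> Some = f"
  by (auto simp: extend_by_def)

lemma extend_by_None [simp]: "extend_by \<H> v f None = ip \<H> f v"
  by (simp add: extend_by_def)

lemma extend_by_Some [simp]: "extend_by \<H> v f (Some x) = f x"
  by (simp add: extend_by_def)

lemma elems_extended [simp]: "elems (extended_space \<H> v) = extend_by \<H> v ` elems \<H>"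
  by (simp add: extended_space_def)

lemma elems_extended_iff:
  "F \<in> elems (extended_space \<H> v) \<longleftrightarrow> F \<circ> Some \<in> elems \<H> \<and> F = extend_by \<H> v (F \<circ> Some)"
  by force

text \<open>
  Restriction to the original points, unlike extension, is linear on all functions; spans in the
  extended space are therefore computed by restricting them.
\<close>

lemma linear_restriction:
  "Vector_Spaces.linear fscale fscale (\<lambda>F :: 'a option \<Rightarrow> complex. F \<circ> Some)"
  unfolding module_hom_iff_linear[symmetric] module_hom_iff
  by (auto simp: fun_space.module_axioms fscale_def fun_eq_iff)

context hilbert_function_space
begin

lemma extended_subspace:
  assumes v: "v \<in> elems \<H>"
  shows "fun_space.subspace (elems (extended_space \<H> v))"
proof (rule fun_space.subspaceI)
  have "extend_by \<H> v 0 = 0"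
    using v by (auto simp: extend_by_def fun_eq_iff ip_zero_left split: option.split)
  then show "0 \<in> elems (extended_space \<H> v)"
    using elems_closed(1) by (metis elems_extended imageI)
next
  fix F G assume "F \<in> elems (extended_space \<H> v)" "G \<in> elems (extended_space \<H> v)"
  then obtain f g where fg: "f \<in> elems \<H>" "g \<in> elems \<H>" "F = extend_by \<H> v f" "G = extend_by \<H> v g"
    by auto
  then have "F + G = extend_by \<H> v (f + g)"
    using v by (auto simp: extend_by_def fun_eq_iff ip_add_left split: option.split)
  then show "F + G \<in> elems (extended_space \<H> v)"
    using fg elems_closed by auto
next
  fix c F assume "F \<in> elems (extended_space \<H> v)"
  then obtain f where f: "f \<in> elems \<H>" "F = extend_by \<H> v f"
    by auto
  then have "fscale c F = extend_by \<H> v (fscale c f)"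
    using v by (auto simp: extend_by_def fun_eq_iff ip_scale_left fscale_def[of c F] fscale_def
        split: option.split) (simp add: ip_scale_left[unfolded fscale_def])
  then show "fscale c F \<in> elems (extended_space \<H> v)"
    using f elems_closed by auto
qed

lemma hdist_extended:
  assumes v: "v \<in> elems \<H>" and "f \<in> elems \<H>" "g \<in> elems \<H>"
  shows "hdist (extended_space \<H> v) (extend_by \<H> v f) (extend_by \<H> v g) = hdist \<H> f g"
proof -
  have "(extend_by \<H> v f - extend_by \<H> v g) \<circ> Some = f - g"
    by (auto simp: fun_eq_iff)
  then show ?thesis
    using assms by (simp add: hdist_def extended_space_def)
qed

lemma Metric_space_extended:
  assumes v: "v \<in> elems \<H>"
  shows "Metric_space (elems (extended_space \<H> v)) (hdist (extended_space \<H> v))"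
proof
  have dist: "hdist (extended_space \<H> v) F G =
      (if F \<in> elems (extended_space \<H> v) \<and> G \<in> elems (extended_space \<H> v)
       then hdist \<H> (F \<circ> Some) (G \<circ> Some) else 0)" for F G
    using hdist_extended[OF v] by (auto simp: hdist_def)
  show "0 \<le> hdist (extended_space \<H> v) F G" for F G
    by (simp only: dist) auto
  show "hdist (extended_space \<H> v) F G = hdist (extended_space \<H> v) G F" for F G
    by (simp only: dist commute conj_commute)
  show "hdist (extended_space \<H> v) F G = 0 \<longleftrightarrow> F = G"
    if "F \<in> elems (extended_space \<H> v)" "G \<in> elems (extended_space \<H> v)" for F G
    using that by (auto simp: hdist_extended[OF v] dest: arg_cong[where f = "\<lambda>F. F \<circ> Some"])
  show "hdist (extended_space \<H> v) F K \<le>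
      hdist (extended_space \<H> v) F G + hdist (extended_space \<H> v) G K"
    if "F \<in> elems (extended_space \<H> v)" "G \<in> elems (extended_space \<H> v)"
      "K \<in> elems (extended_space \<H> v)" for F G K
    using that by (auto simp: hdist_extended[OF v] triangle)
qed

lemma closedin_extended:
  assumes v: "v \<in> elems \<H>" and C: "closedin (htopology \<H>) C"
  shows "closedin (htopology (extended_space \<H> v)) (extend_by \<H> v ` C)"
proof -
  interpret ext: Metric_space "elems (extended_space \<H> v)" "hdist (extended_space \<H> v)"
    using v by (rule Metric_space_extended)
  have sub: "C \<subseteq> elems \<H>" and
    ball: "\<And>x. x \<in> elems \<H> - C \<Longrightarrow> \<exists>r>0. disjnt C (mball x r)"
    using C unfolding closedin_metric by auto
  show ?thesis
    unfolding ext.closedin_metric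
  proof (intro conjI allI impI)
    show "extend_by \<H> v ` C \<subseteq> elems (extended_space \<H> v)" using sub by auto
    fix F assume "F \<in> elems (extended_space \<H> v) - extend_by \<H> v ` C"
    then obtain f where f: "f \<in> elems \<H> - C" "F = extend_by \<H> v f" by auto
    then obtain r where r: "r > 0" "disjnt C (mball f r)" using ball by blast
    have "disjnt (extend_by \<H> v ` C) (ext.mball F r)"
      unfolding disjnt_iff
    proof (intro allI notI)
      fix G assume G: "G \<in> extend_by \<H> v ` C \<and> G \<in> ext.mball F r"
      then obtain g where g: "g \<in> C" "G = extend_by \<H> v g" by auto
      then have "g \<in> mball f r"
        using G f sub hdist_extended[OF v, of f g] unfolding ext.in_mball by auto
      then show False using g r by (auto simp: disjnt_iff)
    qed
    then show "\<exists>r>0. disjnt (extend_by \<H> v ` C) (ext.mball F r)" using r by blast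
  qed
qed

lemma finite_codim_extended:
  assumes v: "v \<in> elems \<H>" and E: "E \<subseteq> elems \<H>" and "finite_codim \<H> E"
  shows "finite_codim (extended_space \<H> v) (extend_by \<H> v ` E)"
proof -
  obtain B where B: "finite B" "B \<subseteq> elems \<H>" "fun_space.span (E \<union> B) = elems \<H>"
    using assms by (auto simp: finite_codim_def)
  interpret restr: Vector_Spaces.linear fscale fscale "\<lambda>F :: 'a option \<Rightarrow> complex. F \<circ> Some"
    by (rule linear_restriction)
  define S where "S = extend_by \<H> v ` (E \<union> B)"
  have "(\<lambda>F. F \<circ> Some) ` S = E \<union> B"
    unfolding S_def by (simp add: image_image)
  then have img: "(\<lambda>F. F \<circ> Some) ` fun_space.span S = elems \<H>"
    using restr.span_image[of S] B(3) by simp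
  have sub: "fun_space.span S \<subseteq> elems (extended_space \<H> v)"
    using E B(2) extended_subspace[OF v] unfolding S_def
    by (intro fun_space.span_minimal) auto
  have "extend_by \<H> v f \<in> fun_space.span S" if "f \<in> elems \<H>" for f
  proof -
    have "f \<in> (\<lambda>F. F \<circ> Some) ` fun_space.span S" using that by (simp only: img)
    then obtain F where F: "F \<in> fun_space.span S" "f = F \<circ> Some" by (rule imageE)
    then have "F \<in> elems (extended_space \<H> v)" using sub by blast
    then have "F = extend_by \<H> v f" unfolding elems_extended_iff F(2) by (rule conjunct2)
    then show ?thesis using F by simp
  qed
  then have "fun_space.span S = elems (extended_space \<H> v)" using sub by auto
  then show ?thesis
    unfolding finite_codim_def using B
    by (intro exI[of _ "extend_by \<H> v ` B"]) (auto simp: S_def image_Un)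
qed

text \<open>
  The set \<open>E\<^sub>\<psi>\<close> of the canonical witness \<open>\<psi>\<close> consists of the extensions of \<open>E\<^sub>\<phi>\<close>: the identity
  assumed on the graph is exactly the multiplier identity at the new point. Closedness and finite
  codimension then carry over along the isometry \<open>f \<mapsto> f\<^sub>v\<close>.
\<close>

lemma sees_iff_graph:
  assumes v: "v \<in> elems \<H>" and \<phi>: "pseudomultiplier \<H> \<phi>"
  shows "sees \<H> \<phi> v c \<longleftrightarrow> (\<forall>(h, g)\<in>pm_graph \<H> \<phi>. ip \<H> g v = c * ip \<H> h v)"
proof
  assume "sees \<H> \<phi> v c"
  then obtain \<psi> where \<psi>: "Some ` dom \<phi> \<subseteq> dom \<psi>" "\<forall>x\<in>dom \<phi>. \<psi> (Some x) = \<phi> x"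
    "pm_dom \<H> \<phi> = (\<lambda>F. F \<circ> Some) ` pm_dom (extended_space \<H> v) \<psi>" "\<psi> None = Some c"
    unfolding sees_def by (elim exE conjE) (rule that; assumption)
  have "ip \<H> g v = c * ip \<H> h v" if hg: "(h, g) \<in> pm_graph \<H> \<phi>" for h g
  proof -
    have "h \<in> pm_dom \<H> \<phi>" using hg by (auto simp: pm_dom_eq_Domain)
    then have "h \<in> (\<lambda>F. F \<circ> Some) ` pm_dom (extended_space \<H> v) \<psi>"
      by (simp only: \<psi>(3))
    then obtain F where F: "F \<in> pm_dom (extended_space \<H> v) \<psi>" "h = F \<circ> Some"
      by (elim imageE)
    then obtain G where G: "G \<in> elems (extended_space \<H> v)" "pm_eq \<psi> F G"
      and Fe: "F \<in> elems (extended_space \<H> v)"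
      by (auto simp: pm_dom_def)
    have Fh: "F = extend_by \<H> v h"
      using Fe F(2) by (simp only: elems_extended_iff)
    obtain g' where g': "g' \<in> elems \<H>" "G = extend_by \<H> v g'" using G(1) by auto
    have "g' x = the (\<phi> x) * h x" if "x \<in> dom \<phi>" for x
    proof -
      have "Some x \<in> dom \<psi>" using that \<psi>(1) by blast
      then have "G (Some x) = the (\<psi> (Some x)) * F (Some x)"
        using G(2) unfolding pm_eq_def by blast
      then show ?thesis using bspec[OF \<psi>(2) that] Fh g' by simp
    qed
    then have "(h, g') \<in> pm_graph \<H> \<phi>"
      using g' hg by (auto simp: pm_graph_def pm_eq_def)
    then have "g' = g"
      using graph_unique[of \<H> \<phi>] hg \<phi> unfolding pseudomultiplier_def by blast
    moreover have "G None = the (\<psi> None) * F None"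
      using G(2) \<psi>(4) unfolding pm_eq_def by blast
    ultimately show ?thesis using \<psi>(4) g' Fh by simp
  qed
  then show "\<forall>(h, g)\<in>pm_graph \<H> \<phi>. ip \<H> g v = c * ip \<H> h v" by blast
next
  assume graph: "\<forall>(h, g)\<in>pm_graph \<H> \<phi>. ip \<H> g v = c * ip \<H> h v"
  define \<psi> where "\<psi> = (\<lambda>y. case y of Some x \<Rightarrow> \<phi> x | None \<Rightarrow> Some c)"
  have dom\<psi>: "dom \<psi> = insert None (Some ` dom \<phi>)"
  proof (rule set_eqI)
    fix y show "y \<in> dom \<psi> \<longleftrightarrow> y \<in> insert None (Some ` dom \<phi>)"
      by (cases y) (auto simp: \<psi>_def)
  qed
  have eq: "pm_eq \<psi> (extend_by \<H> v h) (extend_by \<H> v g) \<longleftrightarrow>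
      pm_eq \<phi> h g \<and> ip \<H> g v = c * ip \<H> h v" for h g
    unfolding pm_eq_def dom\<psi> by (auto simp: \<psi>_def)
  have dom_ext: "pm_dom (extended_space \<H> v) \<psi> = extend_by \<H> v ` pm_dom \<H> \<phi>"
  proof
    show "pm_dom (extended_space \<H> v) \<psi> \<subseteq> extend_by \<H> v ` pm_dom \<H> \<phi>"
      by (auto simp: pm_dom_def eq intro!: imageI)
    show "extend_by \<H> v ` pm_dom \<H> \<phi> \<subseteq> pm_dom (extended_space \<H> v) \<psi>"
      using graph by (simp add: pm_dom_def eq pm_graph_def image_subset_iff) blast
  qed
  have "set_of_uniqueness \<H> (dom \<phi>)" "closedin (htopology \<H>) (pm_dom \<H> \<phi>)"
    "finite_codim \<H> (pm_dom \<H> \<phi>)"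
    using \<phi> by (auto simp: pseudomultiplier_def)
  moreover have "pm_dom \<H> \<phi> \<subseteq> elems \<H>" by (auto simp: pm_dom_def)
  moreover have "set_of_uniqueness (extended_space \<H> v) (dom \<psi>)"
    unfolding set_of_uniqueness_def
  proof (intro conjI ballI impI)
    show "dom \<psi> \<subseteq> points (extended_space \<H> v)"
      using \<phi> by (auto simp: dom\<psi> extended_space_def pseudomultiplier_def set_of_uniqueness_def)
    fix F G
    assume FG: "F \<in> elems (extended_space \<H> v)" "G \<in> elems (extended_space \<H> v)"
      "\<forall>y\<in>dom \<psi>. F y = G y"
    then obtain f g where fg: "f \<in> elems \<H>" "g \<in> elems \<H>"
      "F = extend_by \<H> v f" "G = extend_by \<H> v g" by auto
    then have "\<forall>x\<in>dom \<phi>. f x = g x" using FG(3) by (auto simp: dom\<psi>)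
    then show "F = G"
      using fg \<phi> unfolding pseudomultiplier_def set_of_uniqueness_def by blast
  qed
  ultimately have "pseudomultiplier (extended_space \<H> v) \<psi>"
    unfolding pseudomultiplier_def dom_ext
    using closedin_extended[OF v] finite_codim_extended[OF v] by blast
  then show "sees \<H> \<phi> v c"
    unfolding sees_def
  proof (intro exI[of _ \<psi>] conjI)
    show "Some ` dom \<phi> \<subseteq> dom \<psi>" by (auto simp: dom\<psi>)
    show "pm_dom \<H> \<phi> = (\<lambda>F. F \<circ> Some) ` pm_dom (extended_space \<H> v) \<psi>"
      by (simp add: dom_ext image_image)
  qed (auto simp: \<psi>_def)
qed

lemma sees_kernel_iff_graph:
  assumes "\<alpha> \<in> points \<H>" "pseudomultiplier \<H> \<phi>"
  shows "sees \<H> \<phi> (reproducing_kernel \<H> \<alpha>) c \<longleftrightarrow> (\<forall>(h, g)\<in>pm_graph \<H> \<phi>. g \<alpha> = c * h \<alpha>)"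
  unfolding sees_iff_graph[OF reproducing_kernel(1)[OF assms(1)] assms(2)]
  using reproducing_kernel(2)[OF assms(1)] by (auto simp: pm_graph_def)

lemma sees_arbitrary_iff_graph_vanishes:
  assumes "\<alpha> \<in> points \<H>" "pseudomultiplier \<H> \<phi>"
  shows "(\<forall>c. sees \<H> \<phi> (reproducing_kernel \<H> \<alpha>) c) \<longleftrightarrow> graph_vanishes_at \<H> \<phi> \<alpha>"
proof
  assume sees: "\<forall>c. sees \<H> \<phi> (reproducing_kernel \<H> \<alpha>) c"
  have eq: "\<forall>(h, g)\<in>pm_graph \<H> \<phi>. g \<alpha> = c * h \<alpha>" for c
    using sees unfolding sees_kernel_iff_graph[OF assms] by blast
  show "graph_vanishes_at \<H> \<phi> \<alpha>"
    using eq[of 0] eq[of 1] unfolding graph_vanishes_at_def by fastforce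
next
  assume "graph_vanishes_at \<H> \<phi> \<alpha>"
  then show "\<forall>c. sees \<H> \<phi> (reproducing_kernel \<H> \<alpha>) c"
    unfolding sees_kernel_iff_graph[OF assms] graph_vanishes_at_def by fastforce
qed

text \<open>
  Seeing \<open>k\<^sub>\<alpha>\<close> at a point outside the domain means that the multiplier identity with value \<open>c\<close> at
  \<open>\<alpha>\<close> already holds on the whole graph.
\<close>

lemma graph_update_of_sees:
  assumes "\<alpha> \<in> points \<H> - dom \<phi>" "pseudomultiplier \<H> \<phi>"
    and "sees \<H> \<phi> (reproducing_kernel \<H> \<alpha>) c"
  shows "pm_graph \<H> (\<phi>(\<alpha> \<mapsto> c)) = pm_graph \<H> \<phi>"
proof -
  have "g \<alpha> = c * h \<alpha>" if "(h, g) \<in> pm_graph \<H> \<phi>" for h g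
    using assms that sees_kernel_iff_graph[of \<alpha> \<phi> c] by blast
  then have "(h, g) \<in> pm_graph \<H> (\<phi>(\<alpha> \<mapsto> c)) \<longleftrightarrow> (h, g) \<in> pm_graph \<H> \<phi>" for h g
    using assms(1) unfolding graph_update by (auto simp: pm_graph_def pm_eq_def)
  then show ?thesis by auto
qed

end

lemma set_of_uniqueness_insert:
  assumes "set_of_uniqueness \<H> D" "\<alpha> \<in> points \<H>"
  shows "set_of_uniqueness \<H> (insert \<alpha> D)"
  using assms by (auto simp: set_of_uniqueness_def)


section \<open>Ambiguous points and seeing with arbitrary value\<close>

theorem theorem2p12:
  fixes \<H> :: "'a function_space" and \<phi> :: "'a \<rightharpoonup> complex" and \<alpha> :: 'a
  assumes "hilbert_function_space \<H>"
    and "pseudomultiplier \<H> \<phi>"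
    and "\<alpha> \<in> points \<H>"
  shows "ambiguous_point \<H> \<phi> \<alpha> \<longleftrightarrow> (\<forall>c. sees \<H> \<phi> (reproducing_kernel \<H> \<alpha>) c)"
proof -
  interpret hilbert_function_space \<H> by fact
  have U: "set_of_uniqueness \<H> (dom \<phi>)" using assms(2) by (simp add: pseudomultiplier_def)
  have arbitrary: "(\<forall>c. sees \<H> \<phi> (reproducing_kernel \<H> \<alpha>) c) \<longleftrightarrow> graph_vanishes_at \<H> \<phi> \<alpha>"
    using assms by (intro sees_arbitrary_iff_graph_vanishes)
  have "ambiguous_point \<H> \<phi> \<alpha> \<longleftrightarrow> graph_vanishes_at \<H> \<phi> \<alpha>"
  proof (cases "\<alpha> \<in> dom \<phi>")
    case True
    then show ?thesis
      using ambiguous_in_dom_iff_graph_vanishes[OF assms(1) U] by (simp add: ambiguous_point_def)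
  next
    case False
    then have \<alpha>: "\<alpha> \<in> points \<H> - dom \<phi>" using assms(3) by blast
    have "ambiguous_in_dom \<H> (\<phi>(\<alpha> \<mapsto> c)) \<alpha> \<longleftrightarrow> graph_vanishes_at \<H> \<phi> \<alpha>"
      if "sees \<H> \<phi> (reproducing_kernel \<H> \<alpha>) c" for c
    proof -
      have "set_of_uniqueness \<H> (dom (\<phi>(\<alpha> \<mapsto> c)))"
        using set_of_uniqueness_insert[OF U assms(3)] by simp
      then have "ambiguous_in_dom \<H> (\<phi>(\<alpha> \<mapsto> c)) \<alpha> \<longleftrightarrow> graph_vanishes_at \<H> (\<phi>(\<alpha> \<mapsto> c)) \<alpha>"
        by (intro ambiguous_in_dom_iff_graph_vanishes[OF assms(1)]) simp_all
      then show ?thesis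
        using graph_update_of_sees[OF \<alpha> assms(2) that] by (simp add: graph_vanishes_at_def)
    qed
    moreover have "\<not> ambiguous_in_dom \<H> \<phi> \<alpha>" using False by (simp add: ambiguous_in_dom_def)
    ultimately show ?thesis
      unfolding ambiguous_point_def using \<alpha> arbitrary by blast
  qed
  then show ?thesis using arbitrary by simp
qed

end
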